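(* The generating function $I_2(x)=\sum_{n\ge0}a_nx^n$, where $a_n$ is the number of involutions of $\{1,\dots,n\}$ which contain $3412$ exactly twice, is given by $$I_2(x)=\frac{1-2x}{2x^2(1-x)}-\frac{1-6x+8x^2+8x^3-15x^4-2x^5+4x^6}{2x^2(1-x)^2}\left(\sqrt{1-2x-3x^2}\right)^{-3}.$$
   Context: An involution is a permutation $\pi$ with $\pi=\pi^{-1}$. A permutation contains $3412$ exactly $r$ times if exactly $r$ of its four-term subsequences (in one-line notation) are order-isomorphic to $3412$. *)

theory Defs
  imports
    Complex_Main
    "HOL-Combinatorics.Permutations"
    "HOL-Computational_Algebra.Formal_Power_Series"
    "HOL-Computational_Algebra.Formal_Laurent_Series"
begin

definition order_isomorphic :: "nat list \<Rightarrow> nat list \<Rightarrow> bool" where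
  "order_isomorphic xs ys \<longleftrightarrow>
     length xs = length ys \<and>
     (\<forall>i < length xs. \<forall>j < length xs. xs ! i < xs ! j \<longleftrightarrow> ys ! i < ys ! j)"

(* A permutation of {1..n} is a function p with p permutes {1..n}; its one-line notation
   is p 1, ..., p n. A subsequence is given by the set S of its positions. *)

definition subseq_at :: "(nat \<Rightarrow> nat) \<Rightarrow> nat set \<Rightarrow> nat list" where
  "subseq_at p S = map p (sorted_list_of_set S)"

definition occurrences :: "nat list \<Rightarrow> nat \<Rightarrow> (nat \<Rightarrow> nat) \<Rightarrow> nat set set" where
  "occurrences \<tau> n p = {S. S \<subseteq> {1..n} \<and> order_isomorphic (subseq_at p S) \<tau>}"

definition contains_exactly :: "nat \<Rightarrow> nat list \<Rightarrow> nat \<Rightarrow> (nat \<Rightarrow> nat) \<Rightarrow> bool" where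
  "contains_exactly r \<tau> n p \<longleftrightarrow> card (occurrences \<tau> n p) = r"

definition involutions :: "nat \<Rightarrow> (nat \<Rightarrow> nat) set" where
  "involutions n = {p. p permutes {1..n} \<and> p = inv p}"

definition I_3412 :: "nat \<Rightarrow> real fps" where
  "I_3412 r = Abs_fps (\<lambda>n. of_nat (card {p \<in> involutions n. contains_exactly r [3, 4, 1, 2] n p}))"

(* The formal square root with constant term 1 (= root 2 1). *)
definition sqrt_1_2x_3x2 :: "real fps" where
  "sqrt_1_2x_3x2 = fps_radical root 2 (1 - 2 * fps_X - 3 * fps_X ^ 2)"

end

theory Submission
  imports Defs
begin

text \<open>
  View an involution as a set of arcs joining \<open>i < p i\<close>, together with fixed points. Two crossing arcs form
  an occurrence of 3412. Let \<open>F\<close> be the generating function in which \<open>x\<close> marks the size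
  and \<open>t\<close> the number of occurrences, and look at \<open>k = p 1\<close>. Either 1 is fixed, or no arc
  crosses \<open>(1, k)\<close>, or some arc \<open>(b, p b)\<close> with \<open>1 < b < k < p b\<close> does. In the last case, an involution with
  fewer than three occurrences preserves the points between 1 and \<open>b\<close> and reverses those between
  \<open>b\<close> and \<open>k\<close>, since each violation produces two further occurrences. Hence, modulo \<open>t^3\<close>,
  \<open>F = 1 + x F + x^2 F^2 + t x^2 F (F - 1 - x F) / (1 - x)\<close>,
  and the coefficients of \<open>t^0\<close>, \<open>t^1\<close>, \<open>t^2\<close> give a quadratic equation for \<open>I_3412 0\<close>, whose
  discriminant is \<open>1 - 2 x - 3 x^2\<close>, and then linear equations for \<open>I_3412 1\<close> and \<open>I_3412 2\<close>.
\<close>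

section \<open>Involutions of finite sets weighted by occurrences of 3412\<close>

definition inv_on :: "nat set \<Rightarrow> (nat \<Rightarrow> nat) set" where
  "inv_on A = {p. p permutes A \<and> (\<forall>x. p (p x) = x)}"

text \<open>An occurrence is recorded by its increasing positions. The set \<open>A\<close> is a
  parameter so that occurrences can be counted inside a single block of positions.\<close>

definition quads :: "nat set \<Rightarrow> (nat \<Rightarrow> nat) \<Rightarrow> (nat \<times> nat \<times> nat \<times> nat) set" where
  "quads A p = {(a, b, c, d). {a, b, c, d} \<subseteq> A \<and> a < b \<and> b < c \<and> c < d \<and>
                 p c < p d \<and> p d < p a \<and> p a < p b}"

text \<open>Here \<open>fps_X\<close> is the variable \<open>t\<close> of the idea; the variable
  marking the size enters only later, as an outer one.\<close>

definition weight :: "nat set \<Rightarrow> (nat \<Rightarrow> nat) \<Rightarrow> real fps" where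
  "weight A p = fps_X ^ card (quads A p)"

definition inv_weight :: "nat set \<Rightarrow> real fps" where
  "inv_weight A = (\<Sum>p\<in>inv_on A. weight A p)"

lemma finite_inv_on [simp]: "finite A \<Longrightarrow> finite (inv_on A)"
  unfolding inv_on_def by (rule finite_subset[OF _ finite_permutations[of A]]) auto

lemma finite_quads [simp]: "finite A \<Longrightarrow> finite (quads A p)"
  by (rule finite_subset[of _ "A \<times> A \<times> A \<times> A"]) (auto simp: quads_def)

lemma mem_quads: "(a, b, c, d) \<in> quads A p \<longleftrightarrow> a \<in> A \<and> b \<in> A \<and> c \<in> A \<and> d \<in> A \<and>
    a < b \<and> b < c \<and> c < d \<and> p c < p d \<and> p d < p a \<and> p a < p b"
  by (auto simp: quads_def)

lemma quads_cong: "(\<And>x. x \<in> A \<Longrightarrow> p x = q x) \<Longrightarrow> quads A p = quads A q"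
  by (auto simp: quads_def)

lemma inv_on_in: "p \<in> inv_on A \<Longrightarrow> x \<in> A \<Longrightarrow> p x \<in> A"
  by (auto simp: inv_on_def permutes_in_image)

lemma inv_on_out: "p \<in> inv_on A \<Longrightarrow> x \<notin> A \<Longrightarrow> p x = x"
  by (auto simp: inv_on_def permutes_def)

lemma inv_on_inv: "p \<in> inv_on A \<Longrightarrow> p (p x) = x"
  by (auto simp: inv_on_def)

lemma inv_onI:
  assumes "\<And>x. x \<in> A \<Longrightarrow> p x \<in> A" "\<And>x. x \<notin> A \<Longrightarrow> p x = x" "\<And>x. x \<in> A \<Longrightarrow> p (p x) = x"
  shows "p \<in> inv_on A"
proof -
  have i: "p (p x) = x" for x using assms by (cases "x \<in> A") auto
  have "\<exists>!x. p x = y" for y using i by metis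
  then show ?thesis using i assms(2) by (auto simp: inv_on_def permutes_def)
qed

section \<open>Splitting an involution into blocks, and relabelling\<close>

definition restrict_perm :: "nat set \<Rightarrow> (nat \<Rightarrow> nat) \<Rightarrow> nat \<Rightarrow> nat" where
  "restrict_perm U p x = (if x \<in> U then p x else x)"

lemma restrict_perm_in_inv_on:
  "p \<in> inv_on A \<Longrightarrow> (\<And>x. x \<in> U \<Longrightarrow> p x \<in> U) \<Longrightarrow> restrict_perm U p \<in> inv_on U"
  by (rule inv_onI) (auto simp: restrict_perm_def inv_on_inv)

lemma weight_restrict_perm [simp]: "weight U (restrict_perm U p) = weight U p"
  using quads_cong[of U "restrict_perm U p" p] by (simp add: weight_def restrict_perm_def)

text \<open>An involution that maps \<open>E\<close> and \<open>Z\<close> to themselves cannot send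
  a point of \<open>Y\<close> there, because it would have to send it back. So the part on
  \<open>Y\<close> is an involution as well, and the parts on \<open>E\<close> and \<open>Y\<close>
  can be chosen independently and glued with \<open>z\<close>.\<close>

lemma bij_betw_split:
  assumes z: "z \<in> inv_on Z" and dj: "E \<inter> Z = {}" "E \<inter> Y = {}" "Z \<inter> Y = {}"
    and A: "A = E \<union> Z \<union> Y"
  shows "bij_betw (\<lambda>p. (restrict_perm E p, restrict_perm Y p))
     {p \<in> inv_on A. (\<forall>x\<in>E. p x \<in> E) \<and> (\<forall>x\<in>Z. p x = z x)} (inv_on E \<times> inv_on Y)"
    (is "bij_betw ?f ?S _")
proof (rule bij_betw_byWitness[where f' = "\<lambda>(e, y) x. if x \<in> E then e x else if x \<in> Z then z x else y x"])
  have Y: "p x \<in> Y" if "p \<in> ?S" "x \<in> Y" for p x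
  proof -
    have p: "p \<in> inv_on A" "\<forall>x\<in>E. p x \<in> E" "\<forall>x\<in>Z. p x = z x" using that by auto
    have "p x \<in> A" using p(1) that A inv_on_in by blast
    moreover have "p x \<notin> E" using p inv_on_inv[OF p(1), of x] dj that(2) by (metis disjoint_iff)
    moreover have "p x \<notin> Z" using p inv_on_inv[OF p(1), of x] dj that(2) inv_on_in[OF z]
      by (metis disjoint_iff)
    ultimately show ?thesis using A by blast
  qed
  show "?f ` ?S \<subseteq> inv_on E \<times> inv_on Y"
  proof
    fix u assume "u \<in> ?f ` ?S"
    then obtain p where p: "p \<in> ?S" "u = ?f p" by blast
    have "restrict_perm E p \<in> inv_on E" "restrict_perm Y p \<in> inv_on Y"
      using p(1) Y[OF p(1)] by (auto intro: restrict_perm_in_inv_on)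
    then show "u \<in> inv_on E \<times> inv_on Y" using p(2) by simp
  qed
  show "\<forall>p\<in>?S. (case ?f p of (e, y) \<Rightarrow> (\<lambda>x. if x \<in> E then e x else if x \<in> Z then z x else y x)) = p"
    using A by (auto simp: restrict_perm_def fun_eq_iff dest: inv_on_out)
  show "\<forall>u\<in>inv_on E \<times> inv_on Y. ?f (case u of (e, y) \<Rightarrow> (\<lambda>x. if x \<in> E then e x else if x \<in> Z then z x else y x)) = u"
    using dj by (auto simp: restrict_perm_def fun_eq_iff dest: inv_on_out)
  show "(\<lambda>(e, y) x. if x \<in> E then e x else if x \<in> Z then z x else y x) ` (inv_on E \<times> inv_on Y) \<subseteq> ?S"
  proof clarify
    fix e y assume e: "e \<in> inv_on E" and y: "y \<in> inv_on Y"
    let ?p = "\<lambda>x. if x \<in> E then e x else if x \<in> Z then z x else y x"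
    have "?p \<in> inv_on A"
    proof (rule inv_onI)
      show "?p x \<in> A" if "x \<in> A" for x
        using that A inv_on_in[OF e] inv_on_in[OF z] inv_on_in[OF y] by auto
      show "?p x = x" if "x \<notin> A" for x
        using that A inv_on_out[OF y] by auto
      show "?p (?p x) = x" if "x \<in> A" for x
        using that A dj inv_on_in[OF e] inv_on_in[OF z] inv_on_in[OF y]
          inv_on_inv[OF e] inv_on_inv[OF z] inv_on_inv[OF y] by (auto simp: disjoint_iff)
    qed
    then show "?p \<in> inv_on A \<and> (\<forall>x\<in>E. ?p x \<in> E) \<and> (\<forall>x\<in>Z. ?p x = z x)"
      using dj inv_on_in[OF e] by auto
  qed
qed

text \<open>The factors are arbitrary functions: the crossing case takes for \<open>h\<close> a
  weight that vanishes when \<open>b\<close> is fixed.\<close>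

lemma sum_split:
  fixes g h :: "(nat \<Rightarrow> nat) \<Rightarrow> 'a::comm_semiring_0"
  assumes z: "z \<in> inv_on Z" and dj: "E \<inter> Z = {}" "E \<inter> Y = {}" "Z \<inter> Y = {}"
    and A: "A = E \<union> Z \<union> Y"
  shows "(\<Sum>p | p \<in> inv_on A \<and> (\<forall>x\<in>E. p x \<in> E) \<and> (\<forall>x\<in>Z. p x = z x).
            g (restrict_perm E p) * h (restrict_perm Y p)) = (\<Sum>p\<in>inv_on E. g p) * (\<Sum>p\<in>inv_on Y. h p)"
  using sum.reindex_bij_betw[OF bij_betw_split[OF assms], of "\<lambda>(e, y). g e * h y"]
  by (simp add: sum_product sum.cartesian_product)

text \<open>Conjugation by \<open>f\<close> carries involutions of \<open>A\<close> to involutions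
  of \<open>B\<close>; as \<open>f\<close> preserves order, it carries occurrences to
  occurrences.\<close>

lemma inv_weight_relabel:
  assumes f: "bij_betw f A B" "strict_mono_on A f"
  shows "inv_weight A = inv_weight B"
proof -
  define g where "g = inv_into A f"
  have g: "bij_betw g B A" using f(1) by (simp add: g_def bij_betw_inv_into)
  have fg: "f (g y) = y" if "y \<in> B" for y using f(1) that by (simp add: g_def bij_betw_inv_into_right)
  have gf: "g (f x) = x" if "x \<in> A" for x using f(1) that by (simp add: g_def bij_betw_inv_into_left)
  have fB: "f x \<in> B" if "x \<in> A" for x using f(1) that by (auto simp: bij_betw_def)
  have gA: "g x \<in> A" if "x \<in> B" for x using g that by (auto simp: bij_betw_def)
  have lt: "f x < f y \<longleftrightarrow> x < y" if "x \<in> A" "y \<in> A" for x y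
    using strict_mono_on_less[OF f(2)] that by blast
  define up where "up p y = (if y \<in> B then f (p (g y)) else y)" for p y
  define dn where "dn p x = (if x \<in> A then g (p (f x)) else x)" for p x
  have bij: "bij_betw up (inv_on A) (inv_on B)"
  proof (rule bij_betw_byWitness[where f' = dn])
    show "\<forall>p\<in>inv_on A. dn (up p) = p"
      by (auto simp: up_def dn_def fun_eq_iff fB gf inv_on_in dest: inv_on_out)
    show "\<forall>p\<in>inv_on B. up (dn p) = p"
      by (auto simp: up_def dn_def fun_eq_iff gA fg inv_on_in dest: inv_on_out)
    show "up ` inv_on A \<subseteq> inv_on B"
      by (auto intro!: inv_onI simp: up_def fB gA gf fg inv_on_in inv_on_inv)
    show "dn ` inv_on B \<subseteq> inv_on A"
      by (auto intro!: inv_onI simp: dn_def fB gA gf fg inv_on_in inv_on_inv)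
  qed
  have w: "weight B (up p) = weight A p" if p: "p \<in> inv_on A" for p
  proof -
    have pA: "p x \<in> A" if "x \<in> A" for x using inv_on_in[OF p that] .
    have gl: "g x < g y \<longleftrightarrow> x < y" if "x \<in> B" "y \<in> B" for x y
      using lt[OF gA[OF that(1)] gA[OF that(2)]] fg that by simp
    have up_f: "up p (f x) = f (p x)" if "x \<in> A" for x using that by (simp add: up_def fB gf)
    have p_g: "p (g x) = g (up p x)" if "x \<in> B" for x using that by (simp add: up_def gA gf pA)
    have upB: "up p x \<in> B" if "x \<in> B" for x using that by (simp add: up_def fB gA pA)
    have "bij_betw (\<lambda>(a, b, c, d). (f a, f b, f c, f d)) (quads A p) (quads B (up p))"
    proof (rule bij_betw_byWitness[where f' = "\<lambda>(a, b, c, d). (g a, g b, g c, g d)"])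
      show "(\<lambda>(a, b, c, d). (f a, f b, f c, f d)) ` quads A p \<subseteq> quads B (up p)"
        by (clarsimp simp: quads_def up_f fB lt pA)
      show "(\<lambda>(a, b, c, d). (g a, g b, g c, g d)) ` quads B (up p) \<subseteq> quads A p"
        by (clarsimp simp: quads_def p_g gA gl upB)
      show "\<forall>u\<in>quads A p. (case case u of (a, b, c, d) \<Rightarrow> (f a, f b, f c, f d) of
              (a, b, c, d) \<Rightarrow> (g a, g b, g c, g d)) = u"
        by (clarsimp simp: quads_def gf)
      show "\<forall>u\<in>quads B (up p). (case case u of (a, b, c, d) \<Rightarrow> (g a, g b, g c, g d) of
              (a, b, c, d) \<Rightarrow> (f a, f b, f c, f d)) = u"
        by (clarsimp simp: quads_def fg)
    qed
    then show ?thesis by (simp add: weight_def bij_betw_same_card)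
  qed
  show ?thesis unfolding inv_weight_def
    using sum.reindex_bij_betw[OF bij, of "weight B"] w by simp
qed

lemma inv_weight_card:
  assumes "finite A"
  shows "inv_weight A = inv_weight {1..card A}"
proof -
  \<comment> \<open>The increasing enumeration of \<open>A\<close>; the shift by 1 is there because
    list indices start at 0.\<close>
  define f where "f i = sorted_list_of_set A ! (i - 1)" for i
  have "bij_betw f {1..card A} A"
  proof -
    have "bij_betw (\<lambda>i. i - 1) {1..card A} {..<card A}"
      by (rule bij_betw_byWitness[where f' = Suc]) auto
    moreover have "bij_betw ((!) (sorted_list_of_set A)) {..<card A} A"
      using assms by (intro bij_betw_nth) auto
    ultimately have "bij_betw ((!) (sorted_list_of_set A) \<circ> (\<lambda>i. i - 1)) {1..card A} A"
      by (rule bij_betw_trans)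
    then show ?thesis by (simp add: f_def[abs_def] o_def)
  qed
  moreover have "strict_mono_on {1..card A} f"
  proof (rule strict_mono_onI)
    fix i j assume "i \<in> {1..card A}" "j \<in> {1..card A}" "i < j"
    then have "i - 1 < j - 1" "j - 1 < length (sorted_list_of_set A)" by auto
    then show "f i < f j"
      unfolding f_def by (rule sorted_wrt_nth_less[OF strict_sorted_list_of_set])
  qed
  ultimately show ?thesis by (rule inv_weight_relabel[symmetric])
qed

section \<open>Decomposition according to the image of 1\<close>

lemma inv_on_fixed_point:
  assumes "m \<in> A"
  shows "{p \<in> inv_on A. p m = m} = inv_on (A - {m})"
proof (intro set_eqI iffI)
  fix p assume p: "p \<in> {p \<in> inv_on A. p m = m}"
  then have "p x \<noteq> m" if "x \<noteq> m" for x using inv_on_inv[of p A x] that by auto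
  then show "p \<in> inv_on (A - {m})"
    using p by (intro inv_onI) (auto simp: inv_on_inv dest: inv_on_in inv_on_out)
next
  fix p assume p: "p \<in> inv_on (A - {m})"
  then have "p m = m" by (auto dest: inv_on_out)
  then show "p \<in> {p \<in> inv_on A. p m = m}"
    using p inv_on_in[OF p] inv_on_out[OF p] inv_on_inv[OF p] assms
    by (auto intro!: inv_onI) (metis DiffI singletonD DiffD1)
qed

text \<open>The smallest position could only play the 3 of 3412, but a fixed minimum takes the
  smallest value, which only the 1 can take.\<close>

lemma quads_fixed_min:
  assumes "\<And>x. x \<in> A \<Longrightarrow> m \<le> x" "p \<in> inv_on A" "p m = m" "m \<in> A"
  shows "quads A p = quads (A - {m}) p"
proof -
  have "p x \<noteq> m" if "x \<noteq> m" for x using inv_on_inv[OF assms(2), of x] assms(3) that by auto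
  moreover have "m \<le> p x" if "x \<in> A" for x using inv_on_in[OF assms(2) that] assms(1) by auto
  ultimately show ?thesis using assms(1,3) by (fastforce simp: quads_def)
qed

lemma sum_weight_fixed_min:
  assumes "m \<in> A" "\<And>x. x \<in> A \<Longrightarrow> m \<le> x"
  shows "(\<Sum>p | p \<in> inv_on A \<and> p m = m. weight A p) = inv_weight (A - {m})"
proof -
  have "(\<Sum>p | p \<in> inv_on A \<and> p m = m. weight A p)
      = (\<Sum>p | p \<in> inv_on A \<and> p m = m. weight (A - {m}) p)"
    by (rule sum.cong) (auto simp: weight_def quads_fixed_min[OF assms(2)] assms(1))
  then show ?thesis using inv_on_fixed_point[OF assms(1)] by (simp add: inv_weight_def)
qed

section \<open>Involutions whose arc at 1 is uncrossed, or crossed by one arc\<close>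

definition arc_perms :: "nat \<Rightarrow> nat \<Rightarrow> (nat \<Rightarrow> nat) set" where
  "arc_perms n k = {p \<in> inv_on {1..n}. (\<forall>x\<in>{2..<k}. p x \<in> {2..<k}) \<and>
      (\<forall>x\<in>{1, k}. p x = transpose 1 k x)}"

text \<open>The prescribed part of an involution whose arc from 1 to \<open>k\<close> is crossed by
  the arc at \<open>b\<close>: the points strictly between \<open>b\<close> and \<open>k\<close> are
  reversed by \<open>x \<mapsto> b + k - x\<close>. The image of \<open>b\<close> stays
  free.\<close>

definition crossing_map :: "nat \<Rightarrow> nat \<Rightarrow> nat \<Rightarrow> nat" where
  "crossing_map b k x = (if x = 1 then k else if x = k then 1
     else if b < x \<and> x < k then b + k - x else x)"

text \<open>Deleting 1, \<^term>\<open>k\<close> and the reversed points between \<^term>\<open>b\<close> and \<^term>\<open>k\<close> destroys exactly one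
  occurrence of 3412, whatever the remaining involution does; it leaves a non-fixed point at
  \<^term>\<open>b\<close>.\<close>

definition crossing_perms :: "nat \<Rightarrow> nat \<Rightarrow> nat \<Rightarrow> (nat \<Rightarrow> nat) set" where
  "crossing_perms n b k = {p \<in> inv_on {1..n}. (\<forall>x\<in>{2..<b}. p x \<in> {2..<b}) \<and>
      (\<forall>x\<in>{1, k} \<union> {b<..<k}. p x = crossing_map b k x)} \<inter> {p. p b \<noteq> b}"

text \<open>The assumptions list the possible types of a position with its value, so that the claim
  becomes linear arithmetic over the combinations of types. An occurrence cannot use 1 or
  \<open>k\<close>, nor straddle \<open>k\<close>.\<close>

lemma arc_quads_arith:
  fixes w x y z pw px py pz k :: nat
  assumes "w = 1 \<and> pw = k \<or> 1 < w \<and> w < k \<and> 1 < pw \<and> pw < k \<or> w = k \<and> pw = 1 \<or> k < w \<and> k < pw"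
    "x = 1 \<and> px = k \<or> 1 < x \<and> x < k \<and> 1 < px \<and> px < k \<or> x = k \<and> px = 1 \<or> k < x \<and> k < px"
    "y = 1 \<and> py = k \<or> 1 < y \<and> y < k \<and> 1 < py \<and> py < k \<or> y = k \<and> py = 1 \<or> k < y \<and> k < py"
    "z = 1 \<and> pz = k \<or> 1 < z \<and> z < k \<and> 1 < pz \<and> pz < k \<or> z = k \<and> pz = 1 \<or> k < z \<and> k < pz"
    "w < x" "x < y" "y < z" "py < pz" "pz < pw" "pw < px" "1 \<le> w" "2 \<le> k"
  shows "1 < w \<and> z < k \<or> k < w"
  using assms by (elim disjE) linarith+

text \<open>The same method with seven types, where \<open>pb\<close> is the image of
  \<open>b\<close> and reversed points satisfy \<open>p i + i = b + k\<close>. The proof splits only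
  on the type of the first position.\<close>

lemma crossing_quads_arith:
  fixes w x y z pw px py pz k b pb:: nat
  assumes "w = 1 \<and> pw = k \<or> 1 < w \<and> w < b \<and> 1 < pw \<and> pw < b \<or> w = b \<and> pw = pb \<or>
    b < w \<and> w < k \<and> pw + w = b + k \<or> w = k \<and> pw = 1 \<or> w = pb \<and> pw = b \<or> k < w \<and> k < pw"
    "x = 1 \<and> px = k \<or> 1 < x \<and> x < b \<and> 1 < px \<and> px < b \<or> x = b \<and> px = pb \<or>
    b < x \<and> x < k \<and> px + x = b + k \<or> x = k \<and> px = 1 \<or> x = pb \<and> px = b \<or> k < x \<and> k < px"
    "y = 1 \<and> py = k \<or> 1 < y \<and> y < b \<and> 1 < py \<and> py < b \<or> y = b \<and> py = pb \<or>
    b < y \<and> y < k \<and> py + y = b + k \<or> y = k \<and> py = 1 \<or> y = pb \<and> py = b \<or> k < y \<and> k < py"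
    "z = 1 \<and> pz = k \<or> 1 < z \<and> z < b \<and> 1 < pz \<and> pz < b \<or> z = b \<and> pz = pb \<or>
    b < z \<and> z < k \<and> pz + z = b + k \<or> z = k \<and> pz = 1 \<or> z = pb \<and> pz = b \<or> k < z \<and> k < pz"
    "w < x" "x < y" "y < z" "py < pz" "pz < pw" "pw < px" "1 \<le> w" "1 < b" "b < k" "k < pb"
  shows "w = 1 \<and> x = b \<and> y = k \<and> z = pb \<or> 1 < w \<and> z < b \<or> (w = b \<or> k < w) \<and> k < x"
proof -
  note o = assms(5-)
  consider "w = 1" "pw = k" | "1 < w" "w < b" "1 < pw" "pw < b" | "w = b" "pw = pb"
    | "b < w" "w < k" "pw + w = b + k" | "w = k" "pw = 1" | "w = pb" | "k < w"
    using assms(1) by blast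
  then show ?thesis
  proof cases
    case 1
    \<comment> \<open>The first value is \<open>k\<close>, so the second exceeds \<open>k\<close>;
      only \<open>b\<close> and points beyond \<open>k\<close> have such values.\<close>
    have x: "x = b \<or> k < x" using assms(2) o 1 by (elim disjE) linarith+
    then have "b \<le> x" using o by linarith
    have "z = k \<or> z = pb \<or> b < z \<and> z < k \<and> pz + z = b + k" using assms(4) o 1 \<open>b \<le> x\<close> by (elim disjE) linarith+
    then have "z = pb \<and> pz = b" using assms(3,4) o 1 \<open>b \<le> x\<close> by (elim disjE) linarith+
    then have z: "z = pb" "pz = b" by simp_all
    then have "y = k" using assms(3) o 1 \<open>b \<le> x\<close> by (elim disjE) linarith+
    then show ?thesis using x z 1 o by linarith
  next
    case 2
    have "z < b" using assms(3,4) o 2 by (elim disjE) linarith+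
    then show ?thesis using 2 by linarith
  next
    case 3
    have "k < x" using assms(2) o 3 by (elim disjE) linarith+
    then show ?thesis using 3 by linarith
  next
    case 4
    \<comment> \<open>After a reversed point, larger values occur only beyond \<open>k\<close>. The
      two small values must then follow beyond \<open>k\<close> too, where \<open>pb\<close> is the
      only point with a value below \<open>k\<close>.\<close>
    have "k < x" using assms(2) o 4 by (elim disjE) linarith+
    then have "y = pb" using assms(3) o 4 by (elim disjE) linarith+
    moreover have "z = pb" using \<open>k < x\<close> assms(4) o 4 by (elim disjE) linarith+
    ultimately show ?thesis using o by linarith
  qed (use o in linarith)+
qed
lemma quads_arc_perms:
  assumes p: "p \<in> arc_perms n k" and k: "2 \<le> k" "k \<le> n"
  shows "quads {1..n} p = quads {2..<k} p \<union> quads {k<..n} p"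
proof -
  have inv: "p \<in> inv_on {1..n}" and E: "2 \<le> i \<Longrightarrow> i < k \<Longrightarrow> 2 \<le> p i \<and> p i < k"
    and p1: "p 1 = k" and pk: "p k = 1" for i
    using p k by (auto simp: arc_perms_def)
  have cat: "i = 1 \<and> p i = k \<or> 1 < i \<and> i < k \<and> 1 < p i \<and> p i < k \<or> i = k \<and> p i = 1 \<or> k < i \<and> k < p i"
    if "1 \<le> i" "i \<le> n" for i
  proof -
    have "1 \<le> p i" using inv_on_in[OF inv, of i] that by auto
    then show ?thesis
      using E[of i] E[of "p i"] p1 pk inv_on_inv[OF inv, of i] that(1)
      by (cases "i = 1"; cases "i = k"; cases "p i = 1"; cases "p i = k"; cases "p i < k"; cases "i < k") auto
  qed
  have "(w, x, y, z) \<in> quads {2..<k} p \<union> quads {k<..n} p" if q: "(w, x, y, z) \<in> quads {1..n} p" for w x y z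
  proof -
    have o: "w < x" "x < y" "y < z" "p y < p z" "p z < p w" "p w < p x" "1 \<le> w" "z \<le> n"
      using q by (auto simp: mem_quads)
    have "1 \<le> x" "1 \<le> y" "1 \<le> z" "w \<le> n" "x \<le> n" "y \<le> n" using o by auto
    note c = cat[OF o(7) this(4)] cat[OF this(1,5)] cat[OF this(2,6)] cat[OF this(3) o(8)]
    have "1 < w \<and> z < k \<or> k < w" by (rule arc_quads_arith[OF c o(1-7) k(1)])
    then show ?thesis using o by (auto simp: mem_quads)
  qed
  moreover have "quads {2..<k} p \<union> quads {k<..n} p \<subseteq> quads {1..n} p"
    using k by (auto simp: quads_def)
  ultimately show ?thesis by auto
qed

lemma weight_arc_perms:
  assumes "p \<in> arc_perms n k" "2 \<le> k" "k \<le> n"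
  shows "weight {1..n} p = weight {2..<k} p * weight {k<..n} p"
proof -
  have "quads {2..<k} p \<inter> quads {k<..n} p = {}" by (auto simp: quads_def)
  then have "card (quads {1..n} p) = card (quads {2..<k} p) + card (quads {k<..n} p)"
    unfolding quads_arc_perms[OF assms] by (simp add: card_Un_disjoint)
  then show ?thesis by (simp add: weight_def power_add)
qed

lemma sum_weight_arc_perms:
  assumes k: "2 \<le> k" "k \<le> n"
  shows "(\<Sum>p\<in>arc_perms n k. weight {1..n} p) = inv_weight {2..<k} * inv_weight {k<..n}"
proof -
  have "transpose 1 k \<in> inv_on {1, k}" by (rule inv_onI) auto
  moreover have "{1..n} = {2..<k} \<union> {1, k} \<union> {k<..n}" using k by auto
  ultimately have "(\<Sum>p\<in>arc_perms n k. weight {2..<k} (restrict_perm {2..<k} p)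
      * weight {k<..n} (restrict_perm {k<..n} p)) = inv_weight {2..<k} * inv_weight {k<..n}"
    unfolding arc_perms_def inv_weight_def by (intro sum_split) auto
  then show ?thesis using weight_arc_perms k by simp
qed

text \<open>The arcs of the reversed block are nested in each other and within the arc from 1 to
  \<open>k\<close>, so they join no occurrence. The only occurrence mixing the blocks is the
  crossing of that arc with the arc at \<open>b\<close>.\<close>

lemma quads_crossing_perms:
  assumes p: "p \<in> crossing_perms n b k" and k: "1 < b" "b < k" "k \<le> n"
  shows "quads {1..n} p = insert (1, b, k, p b) (quads {2..<b} p \<union> quads (insert b {k<..n}) p)"
    and "k < p b"
proof -
  have inv: "p \<in> inv_on {1..n}" and E: "2 \<le> i \<Longrightarrow> i < b \<Longrightarrow> 2 \<le> p i \<and> p i < b"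
    and p1: "p 1 = k" and pk: "p k = 1" and D: "b < i \<Longrightarrow> i < k \<Longrightarrow> p i = b + k - i" and pb: "p b \<noteq> b" for i
    using p k by (auto simp: crossing_perms_def crossing_map_def)
  have pos: "1 \<le> p i" if "1 \<le> i" "i \<le> n" for i using inv_on_in[OF inv, of i] that by auto
  \<comment> \<open>All other points of \<open>{1..k}\<close> are permuted among themselves, so a
    non-fixed \<open>b\<close> must go beyond \<open>k\<close>.\<close>
  show B: "k < p b"
    using pos[of b] k E[of "p b"] D[of "p b"] pb p1 pk inv_on_inv[OF inv, of b]
    by (cases "p b = 1"; cases "p b = k"; cases "p b < b"; cases "p b < k") auto
  have cat: "i = 1 \<and> p i = k \<or> 1 < i \<and> i < b \<and> 1 < p i \<and> p i < b \<or> i = b \<and> p i = p b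
      \<or> b < i \<and> i < k \<and> p i + i = b + k \<or> i = k \<and> p i = 1 \<or> i = p b \<and> p i = b \<or> k < i \<and> k < p i"
    if "1 \<le> i" "i \<le> n" for i
  proof -
    have "k < i \<Longrightarrow> k < p i \<or> i = p b"
      using pos[OF that] k E[of "p i"] D[of "p i"] p1 pk inv_on_inv[OF inv, of i]
      by (cases "p i = 1"; cases "p i = k"; cases "p i < b"; cases "p i < k"; cases "p i = b") auto
    then show ?thesis
      using E[of i] D[of i] p1 pk that(1) inv_on_inv[OF inv, of b]
      by (cases "i = 1"; cases "i = k"; cases "i < b"; cases "i = b"; cases "i < k") auto
  qed
  have "(w, x, y, z) \<in> insert (1, b, k, p b) (quads {2..<b} p \<union> quads (insert b {k<..n}) p)"
    if q: "(w, x, y, z) \<in> quads {1..n} p" for w x y z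
  proof -
    have o: "w < x" "x < y" "y < z" "p y < p z" "p z < p w" "p w < p x" "1 \<le> w" "z \<le> n"
      using q by (auto simp: mem_quads)
    have "1 \<le> x" "1 \<le> y" "1 \<le> z" "w \<le> n" "x \<le> n" "y \<le> n" using o by auto
    note c = cat[OF o(7) this(4)] cat[OF this(1,5)] cat[OF this(2,6)] cat[OF this(3) o(8)]
    have "w = 1 \<and> x = b \<and> y = k \<and> z = p b \<or> 1 < w \<and> z < b \<or> (w = b \<or> k < w) \<and> k < x"
      by (rule crossing_quads_arith[OF c o(1-7) k(1,2) B])
    then show ?thesis using o by (auto simp: mem_quads)
  qed
  moreover have "quads {2..<b} p \<union> quads (insert b {k<..n}) p \<subseteq> quads {1..n} p"
    using k by (auto simp: quads_def)
  moreover have "(1, b, k, p b) \<in> quads {1..n} p"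
    using k B p1 pk inv_on_inv[OF inv, of b] inv_on_in[OF inv, of b] by (auto simp: mem_quads)
  ultimately show "quads {1..n} p = insert (1, b, k, p b) (quads {2..<b} p \<union> quads (insert b {k<..n}) p)"
    by auto
qed

lemma weight_crossing_perms:
  assumes p: "p \<in> crossing_perms n b k" and k: "1 < b" "b < k" "k \<le> n"
  shows "weight {1..n} p = fps_X * (weight {2..<b} p * weight (insert b {k<..n}) p)"
proof -
  have "quads {2..<b} p \<inter> quads (insert b {k<..n}) p = {}"
    using k by (auto simp: quads_def)
  moreover have "(1, b, k, p b) \<notin> quads {2..<b} p \<union> quads (insert b {k<..n}) p"
    using k by (auto simp: mem_quads)
  ultimately have "card (quads {1..n} p)
      = Suc (card (quads {2..<b} p) + card (quads (insert b {k<..n}) p))"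
    unfolding quads_crossing_perms(1)[OF assms] by (simp add: card_Un_disjoint)
  then show ?thesis by (simp add: weight_def power_add)
qed

text \<open>The factor \<open>fps_X\<close> is the occurrence \<open>(1, b, k, p b)\<close>. The
  difference excludes the involutions of the last block that fix its minimum \<open>b\<close>; a
  fixed minimum lies in no occurrence.\<close>

lemma sum_weight_crossing_perms:
  assumes k: "1 < b" "b < k" "k \<le> n"
  shows "(\<Sum>p\<in>crossing_perms n b k. weight {1..n} p)
    = fps_X * inv_weight {2..<b} * (inv_weight (insert b {k<..n}) - inv_weight {k<..n})"
proof -
  define Y where "Y = insert b {k<..n}"
  define Z where "Z = {1, k} \<union> {b<..<k}"
  define S where "S = {p \<in> inv_on {1..n}. (\<forall>x\<in>{2..<b}. p x \<in> {2..<b}) \<and> (\<forall>x\<in>Z. p x = crossing_map b k x)}"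
  \<comment> \<open>The condition that \<open>b\<close> is not fixed is moved into the second
    factor, so that \<open>sum_split\<close> applies.\<close>
  define h where "h q = (if q b = b then 0 else weight Y q)" for q
  have "crossing_map b k \<in> inv_on Z"
    unfolding Z_def using k by (intro inv_onI) (auto simp: crossing_map_def)
  moreover have "{1..n} = {2..<b} \<union> Z \<union> Y" using k by (auto simp: Y_def Z_def)
  ultimately have *: "(\<Sum>p\<in>S. weight {2..<b} (restrict_perm {2..<b} p) * h (restrict_perm Y p))
      = inv_weight {2..<b} * (\<Sum>q\<in>inv_on Y. h q)"
    unfolding S_def inv_weight_def using k by (intro sum_split) (auto simp: Y_def Z_def)
  have hr: "h (restrict_perm Y p) = h p" for p
    by (simp add: h_def) (simp add: restrict_perm_def Y_def)
  have fin: "finite S" by (auto simp: S_def)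
  have SS: "crossing_perms n b k = S \<inter> {p. p b \<noteq> b}" by (simp add: crossing_perms_def S_def Z_def)
  have "(\<Sum>p\<in>crossing_perms n b k. weight {1..n} p)
      = (\<Sum>p\<in>crossing_perms n b k. fps_X * (weight {2..<b} p * h p))"
    using weight_crossing_perms[OF _ k] by (intro sum.cong) (auto simp: h_def SS Y_def)
  also have "\<dots> = (\<Sum>p\<in>S. fps_X * (weight {2..<b} p * h p))"
    using fin by (intro sum.mono_neutral_left) (auto simp: SS h_def)
  also have "\<dots> = fps_X * (inv_weight {2..<b} * (\<Sum>q\<in>inv_on Y. h q))"
    using * by (simp add: hr sum_distrib_left[symmetric])
  also have "(\<Sum>q\<in>inv_on Y. h q) = inv_weight Y - (\<Sum>q | q \<in> inv_on Y \<and> q b = b. weight Y q)"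
  proof -
    have "inv_weight Y = (\<Sum>q\<in>inv_on Y. h q + (if q b = b then weight Y q else 0))"
      unfolding inv_weight_def by (intro sum.cong) (auto simp: h_def)
    also have "\<dots> = (\<Sum>q\<in>inv_on Y. h q) + (\<Sum>q | q \<in> inv_on Y \<and> q b = b. weight Y q)"
      by (simp add: sum.distrib sum.inter_filter[symmetric] Y_def)
    finally show ?thesis by simp
  qed
  also have "(\<Sum>q | q \<in> inv_on Y \<and> q b = b. weight Y q) = inv_weight {k<..n}"
    proof -
    have "Y - {b} = {k<..n}" "b \<in> Y" "\<And>x. x \<in> Y \<Longrightarrow> b \<le> x" using k by (auto simp: Y_def)
    then show ?thesis using sum_weight_fixed_min[of b Y] by simp
  qed
  finally show ?thesis by (simp add: Y_def mult.assoc)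
qed

section \<open>Classification of involutions with fewer than three occurrences\<close>

lemma three_quads:
  assumes "finite A" "u \<in> quads A p" "v \<in> quads A p" "w \<in> quads A p" "u \<noteq> v" "u \<noteq> w" "v \<noteq> w"
  shows "3 \<le> card (quads A p)"
  using card_mono[of "quads A p" "{u, v, w}"] assms by simp

text \<open>By monotonicity \<open>p\<close> maps the points between \<open>i\<close> and
  \<open>k\<close> onto those between \<open>b\<close> and \<open>p i\<close>; equal cardinalities
  determine \<open>p i\<close>.\<close>

lemma decreasing_inv_on_eq:
  assumes inv: "p \<in> inv_on A" and D: "\<And>i. b < i \<Longrightarrow> i < k \<Longrightarrow> b < p i \<and> p i < k"
    and dec: "\<And>i j. b < i \<Longrightarrow> i < j \<Longrightarrow> j < k \<Longrightarrow> p j < p i" and i: "b < i" "i < k"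
  shows "p i = b + k - i"
proof -
  have img: "p ` {i<..<k} = {b<..<p i}"
  proof (intro set_eqI iffI)
    fix y assume "y \<in> {b<..<p i}"
    then have "p y \<in> {i<..<k}" "p (p y) = y"
      using D[of y] D[of i] dec[of y "p i"] i inv_on_inv[OF inv] by auto
    then show "y \<in> p ` {i<..<k}" by (metis imageI)
  qed (use D dec i in \<open>auto simp: image_iff\<close>)
  have "inj_on p {i<..<k}" by (rule inj_on_inverseI[of _ p]) (rule inv_on_inv[OF inv])
  then have "card {i<..<k} = card {b<..<p i}" using card_image img by metis
  then show ?thesis using i D[of i] by (simp, arith)
qed

lemma inv_on_cases:
  assumes inv: "p \<in> inv_on {1..n}" and n: "1 \<le> n" and few: "card (quads {1..n} p) < 3"
  shows "p 1 = 1 \<or> (\<exists>k\<in>{2..n}. p \<in> arc_perms n k) \<or>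
         (\<exists>k\<in>{2..n}. \<exists>b\<in>{2..<k}. p \<in> crossing_perms n b k)"
proof (cases "p 1 = 1")
  case False
  define k where "k = p 1"
  have k: "2 \<le> k" "k \<le> n" using inv_on_in[OF inv, of 1] n False by (auto simp: k_def)
  have p1: "p 1 = k" and pk: "p k = 1" using inv_on_inv[OF inv] by (auto simp: k_def)
  have pp: "p (p x) = x" for x by (rule inv_on_inv[OF inv])
  have rng: "1 \<le> p x \<and> p x \<le> n" if "1 \<le> x" "x \<le> n" for x using inv_on_in[OF inv, of x] that by auto
  have no3: False if "u \<in> quads {1..n} p" "v \<in> quads {1..n} p" "w \<in> quads {1..n} p"
    "u \<noteq> v" "u \<noteq> w" "v \<noteq> w" for u v w
    using three_quads[OF _ that] few by simp
  have ne: "p x \<noteq> 1 \<and> p x \<noteq> k" if "x \<noteq> 1" "x \<noteq> k" for x using pp[of x] p1 pk that by auto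
  show ?thesis
  proof (cases "\<forall>x\<in>{2..<k}. p x \<in> {2..<k}")
    case True
    then have "p \<in> arc_perms n k" using inv p1 pk by (auto simp: arc_perms_def)
    then show ?thesis using k by auto
  next
    case F: False
    have "\<exists>b. 1 < b \<and> b < k \<and> k < p b"
    proof -
      obtain x where x: "2 \<le> x" "x < k" "p x \<notin> {2..<k}" using F by auto
      then show ?thesis using ne[of x] rng[of x] k by (intro exI[of _ x]) auto
    qed
    then obtain b where b: "1 < b" "b < k" "k < p b" by auto
    have pb: "p b \<le> n" using rng[of b] b k by auto
    have q0: "(1, b, k, p b) \<in> quads {1..n} p"
      using b k pb pp p1 pk by (auto simp: mem_quads)
    \<comment> \<open>Each of two arcs crossing the arc at 1 gives an occurrence with it. If the two
      cross each other, that is a third one; if they are nested, \<open>(1, c, k, p d)\<close>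
      is.\<close>
    have two: False if c: "1 < c" "c < d" "d < k" "k < p c" "k < p d" for c d
    proof -
      have r: "p c \<le> n" "p d \<le> n" using rng c k by auto
      have q: "(1, c, k, p c) \<in> quads {1..n} p" "(1, d, k, p d) \<in> quads {1..n} p"
        using c k r pp p1 pk by (auto simp: mem_quads)
      have "p c \<noteq> p d" using pp[of c] pp[of d] c by auto
      then consider "p c < p d" | "p d < p c" by linarith
      then show False
      proof cases
        case 1
        from 1 have "(c, d, p c, p d) \<in> quads {1..n} p" using c k r pp by (auto simp: mem_quads)
        then show ?thesis using no3[OF q, of "(c, d, p c, p d)"] c by simp
      next
        case 2
        have "(1, c, k, p d) \<in> quads {1..n} p" using 2 c k r pp p1 pk by (auto simp: mem_quads)
        then show ?thesis using no3[OF q, of "(1, c, k, p d)"] c 2 by simp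
      qed
    qed
    have uniq: "p i < k" if "1 < i" "i < k" "i \<noteq> b" for i
    proof -
      have "\<not> k < p i"
        using two[of i b] two[of b i] that b by (cases "i < b") auto
      then show ?thesis using ne[of i] that by auto
    qed
    \<comment> \<open>An arc from \<open>i < b\<close> to a point between \<open>b\<close> and
      \<open>k\<close> crosses the arc at \<open>b\<close>; it also yields
      \<open>(1, b, p i, p b)\<close>, with values \<open>k\<close>, \<open>p b\<close>,
      \<open>i\<close>, \<open>b\<close>.\<close>
    have E: "p i < b" if "1 < i" "i < b" for i
    proof (rule ccontr)
      assume "\<not> p i < b"
      then have i: "b < p i" "p i < k" using uniq[of i] that b pp[of i] by (auto simp: order_less_le)
      have "(i, b, p i, p b) \<in> quads {1..n} p" "(1, b, p i, p b) \<in> quads {1..n} p"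
        using i that b k pb pp p1 pk by (auto simp: mem_quads)
      then show False using no3[OF q0, of "(i, b, p i, p b)" "(1, b, p i, p b)"] i that by simp
    qed
    have D: "b < p i \<and> p i < k" if "b < i" "i < k" for i
    proof -
      have "p i < k" using uniq[of i] that b by auto
      moreover have "p i \<noteq> b" using pp[of i] that b by auto
      moreover have "\<not> p i < b"
        using E[of "p i"] pp[of i] that ne[of i] rng[of i] b k by (auto simp: order_less_le)
      ultimately show ?thesis by auto
    qed
    \<comment> \<open>An ascent \<open>p i < p j\<close> inside the block gives
      \<open>(1, b, i, j)\<close> and, by passing to the inverse,
      \<open>(p i, p j, k, p b)\<close>.\<close>
    have dec: "p j < p i" if ij: "b < i" "i < j" "j < k" for i j
    proof (rule ccontr)
      assume "\<not> p j < p i"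
      moreover have "p i \<noteq> p j" using pp[of i] pp[of j] ij by auto
      ultimately have lt: "p i < p j" by auto
      have "(1, b, i, j) \<in> quads {1..n} p" "(p i, p j, k, p b) \<in> quads {1..n} p"
        using lt ij b k pb D[of i] D[of j] pp p1 pk by (auto simp: mem_quads)
      moreover have "i \<noteq> k" "1 \<noteq> p i" using ij D[of i] b by auto
      ultimately show False using no3[OF q0, of "(1, b, i, j)" "(p i, p j, k, p b)"] by simp
    qed
    have rev: "p i = b + k - i" if "b < i" "i < k" for i
      using decreasing_inv_on_eq[OF inv D dec that] .
    have "p x \<in> {2..<b}" if "x \<in> {2..<b}" for x
      using E[of x] that ne[of x] rng[of x] b k by auto
    moreover have "p x = crossing_map b k x" if "x \<in> {1, k} \<union> {b<..<k}" for x
      using that rev p1 pk k b by (auto simp: crossing_map_def)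
    ultimately have "p \<in> crossing_perms n b k" using inv b by (auto simp: crossing_perms_def)
    moreover have "k \<in> {2..n}" "b \<in> {2..<k}" using b k by auto
    ultimately show ?thesis by blast
  qed
qed simp

section \<open>The recurrence for the occurrence polynomials, modulo \<open>t^3\<close>\<close>

definition inv_poly :: "nat \<Rightarrow> real fps" where
  "inv_poly n = inv_weight {1..n}"

lemma inv_weight_eq_inv_poly: "finite A \<Longrightarrow> inv_weight A = inv_poly (card A)"
  unfolding inv_poly_def by (rule inv_weight_card)

lemma quads_empty: "quads {} p = {}"
  by (auto simp: quads_def)

lemma inv_poly_0: "inv_poly 0 = 1"
proof -
  have "inv_on {} = {id}" by (auto simp: inv_on_def)
  then show ?thesis by (simp add: inv_poly_def inv_weight_def weight_def quads_empty)
qed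

lemma arc_permsD:
  assumes "p \<in> arc_perms n k"
  shows "p \<in> inv_on {1..n}" "p 1 = k" "1 < x \<Longrightarrow> x < k \<Longrightarrow> p x < k"
proof -
  show "p \<in> inv_on {1..n}" using assms unfolding arc_perms_def by blast
  have "p 1 = transpose 1 k 1" using assms unfolding arc_perms_def by blast
  then show "p 1 = k" by (simp only: transpose_apply_first)
  have "\<forall>x\<in>{2..<k}. p x \<in> {2..<k}" using assms unfolding arc_perms_def by blast
  then show "1 < x \<Longrightarrow> x < k \<Longrightarrow> p x < k" by fastforce
qed

text \<open>These facts recover \<open>k\<close> and \<open>b\<close> from \<open>p\<close>:
  \<open>k\<close> is the image of 1, and \<open>b\<close> is the only point between 1 and
  \<open>k\<close> whose image lies beyond \<open>k\<close>. Hence the families in the decomposition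
  are disjoint.\<close>

lemma crossing_permsD:
  assumes p: "p \<in> crossing_perms n b k" and bk: "b \<in> {2..<k}" "k \<in> {2..n}"
  shows "p \<in> inv_on {1..n}" "p 1 = k" "k < p b" "1 < x \<Longrightarrow> x < k \<Longrightarrow> k < p x \<Longrightarrow> x = b"
proof -
  show "p \<in> inv_on {1..n}" using p unfolding crossing_perms_def by blast
  show "k < p b" using bk by (intro quads_crossing_perms(2)[OF p]) auto
  have "p 1 = crossing_map b k 1" using p unfolding crossing_perms_def by blast
  then show "p 1 = k" by (simp only: crossing_map_def if_True simp_thms)
  have E: "\<forall>x\<in>{2..<b}. p x \<in> {2..<b}" and D: "\<forall>x\<in>{1, k} \<union> {b<..<k}. p x = crossing_map b k x"
    using p unfolding crossing_perms_def by blast+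
  show "x = b" if x: "1 < x" "x < k" "k < p x"
  proof (rule ccontr)
    assume "x \<noteq> b"
    show False
    proof (cases "x < b")
      case True
      then have "p x < b" using E x by fastforce
      then show False using x bk by simp
    next
      case False
      then have "p x = crossing_map b k x" "b < x" using D x \<open>x \<noteq> b\<close> by auto
      then show False using x by (simp add: crossing_map_def)
    qed
  qed
qed

text \<open>Only the coefficients below 3 agree: the involutions not covered by the decomposition contribute
  higher powers.\<close>

lemma inv_poly_rec:
  assumes n: "1 \<le> n" and r: "r < 3"
  shows "inv_poly n $ r = (inv_poly (n - 1) + (\<Sum>k=2..n. inv_poly (k - 2) * inv_poly (n - k))
     + (\<Sum>k=2..n. \<Sum>b=2..<k. fps_X * inv_poly (b - 2) * (inv_poly (n - k + 1) - inv_poly (n - k)))) $ r"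
proof -
  define A B where "A = {p \<in> inv_on {1..n}. p 1 = 1}" and "B = (\<Union>k\<in>{2..n}. arc_perms n k)"
  define C where "C = (\<Union>(k, b)\<in>(SIGMA k:{2..n}. {2..<k}). crossing_perms n b k)"
  define R where "R = inv_on {1..n} - (A \<union> B \<union> C)"
  have fin [simp]: "finite A" "finite (arc_perms n k)" "finite (crossing_perms n b k)" for b k
    by (auto simp: A_def arc_perms_def crossing_perms_def)
  then have [simp]: "finite B" "finite C" "finite R" by (auto simp: B_def C_def R_def)
  have sub: "A \<subseteq> inv_on {1..n}" "B \<subseteq> inv_on {1..n}" "C \<subseteq> inv_on {1..n}"
    by (auto simp: A_def B_def C_def arc_perms_def crossing_perms_def)
  have AB: "A \<inter> B = {}"
  proof -
    have "p \<notin> B" if "p \<in> A" for p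
    proof
      assume "p \<in> B"
      then obtain k where "k \<in> {2..n}" "p \<in> arc_perms n k" unfolding B_def by blast
      then show False using arc_permsD(2) that unfolding A_def by fastforce
    qed
    then show ?thesis by blast
  qed
  have ABC: "(A \<union> B) \<inter> C = {}"
  proof -
    have "p \<notin> C" if "p \<in> A" for p
    proof
      assume "p \<in> C"
      then obtain k b where "k \<in> {2..n}" "b \<in> {2..<k}" "p \<in> crossing_perms n b k" unfolding C_def by blast
      then show False using crossing_permsD(2) that unfolding A_def by fastforce
    qed
    moreover have "p \<notin> C" if pB: "p \<in> B" for p
    proof
      assume "p \<in> C"
      then obtain k b where kb: "k \<in> {2..n}" "b \<in> {2..<k}" "p \<in> crossing_perms n b k" unfolding C_def by blast
      obtain k' where k': "p \<in> arc_perms n k'" using pB unfolding B_def by blast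
      have "k = k'" using arc_permsD(2)[OF k'] crossing_permsD(2)[OF kb(3,2,1)] by simp
      then have "p b < k" "k < p b"
        using arc_permsD(3)[OF k', of b] crossing_permsD(3)[OF kb(3,2,1)] kb by auto
      then show False by simp
    qed
    ultimately show ?thesis by blast
  qed
  have un: "inv_on {1..n} = A \<union> B \<union> C \<union> R"
    using sub by (auto simp: R_def)
  have RR: "(A \<union> B \<union> C) \<inter> R = {}" by (auto simp: R_def)
  have "inv_poly n = sum (weight {1..n}) A + sum (weight {1..n}) B + sum (weight {1..n}) C
      + sum (weight {1..n}) R"
    unfolding inv_poly_def inv_weight_def un
    using AB ABC RR by (simp add: sum.union_disjoint)
  moreover have "sum (weight {1..n}) A = inv_poly (n - 1)"
  proof -
    have "sum (weight {1..n}) A = inv_weight ({1..n} - {1})"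
      unfolding A_def using n by (intro sum_weight_fixed_min) auto
    then show ?thesis using n by (simp add: inv_weight_eq_inv_poly)
  qed
  moreover have "sum (weight {1..n}) B = (\<Sum>k=2..n. inv_poly (k - 2) * inv_poly (n - k))"
  proof -
    have "sum (weight {1..n}) B = (\<Sum>k=2..n. sum (weight {1..n}) (arc_perms n k))"
      unfolding B_def
    proof (intro sum.UNION_disjoint ballI impI)
      show "arc_perms n k \<inter> arc_perms n k' = {}" if "k \<noteq> k'" for k k'
        using that arc_permsD(2) by blast
    qed auto
    also have "\<dots> = (\<Sum>k=2..n. inv_poly (k - 2) * inv_poly (n - k))"
      by (intro sum.cong) (auto simp: sum_weight_arc_perms inv_weight_eq_inv_poly simp del: One_nat_def)
    finally show ?thesis .
  qed
  moreover have "sum (weight {1..n}) C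
     = (\<Sum>k=2..n. \<Sum>b=2..<k. fps_X * inv_poly (b - 2) * (inv_poly (n - k + 1) - inv_poly (n - k)))"
  proof -
    have "sum (weight {1..n}) C = (\<Sum>u\<in>(SIGMA k:{2..n}. {2..<k}).
        sum (weight {1..n}) (case u of (k, b) \<Rightarrow> crossing_perms n b k))"
      unfolding C_def
    proof (intro sum.UNION_disjoint ballI impI)
      fix u v assume uv: "u \<in> (SIGMA k:{2..n}. {2..<k})" "v \<in> (SIGMA k:{2..n}. {2..<k})" "u \<noteq> v"
      obtain k b where u: "u = (k, b)" by (cases u)
      obtain k' b' where v: "v = (k', b')" by (cases v)
      show "(case u of (k, b) \<Rightarrow> crossing_perms n b k) \<inter> (case v of (k, b) \<Rightarrow> crossing_perms n b k) = {}"
      proof (rule ccontr)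
        assume "\<not> ?thesis"
        then obtain p where "p \<in> crossing_perms n b k" "p \<in> crossing_perms n b' k'" by (auto simp: u v)
        then have "k = k' \<and> b = b'"
          using crossing_permsD(2)[of p n b k] crossing_permsD(2)[of p n b' k']
            crossing_permsD(3)[of p n b k] crossing_permsD(4)[of p n b' k' b] uv by (auto simp: u v)
        then show False using uv u v by simp
      qed
    qed auto
    also have "\<dots> = (\<Sum>k=2..n. \<Sum>b=2..<k. sum (weight {1..n}) (crossing_perms n b k))"
      by (subst sum.Sigma) (auto simp: split_def)
    \<comment> \<open>The last block consists of \<open>b\<close> and the \<open>n - k\<close>
      points beyond \<open>k\<close>, hence the size \<open>n - k + 1\<close>.\<close>
    also have "\<dots> = (\<Sum>k=2..n. \<Sum>b=2..<k. fps_X * inv_poly (b - 2) * (inv_poly (n - k + 1) - inv_poly (n - k)))"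
      by (intro sum.cong refl, subst sum_weight_crossing_perms)
        (auto simp: inv_weight_eq_inv_poly)
    finally show ?thesis .
  qed
  moreover have "sum (weight {1..n}) R $ r = 0"
  proof -
    \<comment> \<open>By \<open>inv_on_cases\<close> an involution outside the decomposition has at
      least three occurrences, so its weight is divisible by \<open>fps_X ^ 3\<close>.\<close>
    have "weight {1..n} p $ r = 0" if "p \<in> R" for p
    proof -
      have "\<not> card (quads {1..n} p) < 3"
        using inv_on_cases[of p n] n that by (auto simp: R_def A_def B_def C_def)
      then show ?thesis using r by (auto simp: weight_def)
    qed
    then show ?thesis by (simp add: fps_sum_nth)
  qed
  ultimately show ?thesis by simp
qed

section \<open>Occurrences as quadruples\<close>

lemma involutions_eq_inv_on: "involutions n = inv_on {1..n}"
proof -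
  have "p = inv p \<longleftrightarrow> (\<forall>x. p (p x) = x)" if "p permutes {1..n}" for p
  proof
    assume "p = inv p"
    then show "\<forall>x. p (p x) = x" using permutes_inverses(1)[OF that] by simp
  next
    assume "\<forall>x. p (p x) = x"
    then have "inv p = p" by (intro inv_equality) auto
    then show "p = inv p" by (rule sym)
  qed
  then show ?thesis by (auto simp: involutions_def inv_on_def)
qed

lemma order_isomorphic_3412:
  "order_isomorphic [w, x, y, z] [3, 4, 1, 2] \<longleftrightarrow> y < z \<and> z < w \<and> w < x"
    (is "?iso \<longleftrightarrow> ?lt")
proof
  assume ?iso
  then have *: "i < 4 \<Longrightarrow> j < 4 \<Longrightarrow>
      [w, x, y, z] ! i < [w, x, y, z] ! j \<longleftrightarrow> [3, 4, 1, 2 :: nat] ! i < [3, 4, 1, 2] ! j" for i j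
    by (simp add: order_isomorphic_def)
  \<comment> \<open>The entries 1, 2, 3, 4 of the pattern stand at the indices 2, 3, 0, 1;
    consecutive ones are compared.\<close>
  show ?lt using *[of 2 3] *[of 3 0] *[of 0 1] by simp
next
  assume lt: ?lt
  have "[w, x, y, z] ! i < [w, x, y, z] ! j \<longleftrightarrow> [3, 4, 1, 2 :: nat] ! i < [3, 4, 1, 2] ! j"
    if "i < 4" "j < 4" for i j
  proof -
    have "i = 0 \<or> i = 1 \<or> i = 2 \<or> i = 3" "j = 0 \<or> j = 1 \<or> j = 2 \<or> j = 3" using that by auto
    then show ?thesis using lt by (elim disjE) simp_all
  qed
  then show ?iso by (simp add: order_isomorphic_def)
qed

lemma sorted_list_of_set_quadruple:
  fixes a b c d :: nat
  assumes "a < b" "b < c" "c < d"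
  shows "sorted_list_of_set {a, b, c, d} = [a, b, c, d]"
  using sorted_list_of_set.idem_if_sorted_distinct[of "[a, b, c, d]"] assms by simp

text \<open>A set of four positions has exactly one increasing enumeration, so position sets and
  increasing quadruples correspond.\<close>

lemma card_occurrences_3412: "card (occurrences [3, 4, 1, 2] n p) = card (quads {1..n} p)"
proof -
  let ?g = "\<lambda>(a, b, c, d). {a, b, c, d :: nat}"
  have "inj_on ?g (quads {1..n} p)"
  proof (rule inj_on_inverseI)
    show "(\<lambda>L. (L ! 0, L ! 1, L ! 2, L ! 3)) (sorted_list_of_set (?g q)) = q" if "q \<in> quads {1..n} p" for q
      using that by (cases q) (simp add: mem_quads sorted_list_of_set_quadruple)
  qed
  moreover have "?g ` quads {1..n} p = occurrences [3, 4, 1, 2] n p"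
  proof (intro equalityI subsetI)
    fix S assume "S \<in> ?g ` quads {1..n} p"
    then obtain a b c d where q: "(a, b, c, d) \<in> quads {1..n} p" and S: "S = {a, b, c, d}" by auto
    then have "subseq_at p S = [p a, p b, p c, p d]"
      by (simp add: subseq_at_def sorted_list_of_set_quadruple mem_quads)
    then show "S \<in> occurrences [3, 4, 1, 2] n p"
      using q S by (simp add: occurrences_def order_isomorphic_3412[unfolded One_nat_def] mem_quads)
  next
    fix S assume S: "S \<in> occurrences [3, 4, 1, 2] n p"
    define L where "L = sorted_list_of_set S"
    have iso: "order_isomorphic (map p L) [3, 4, 1, 2]" and sub: "S \<subseteq> {1..n}"
      using S by (auto simp: occurrences_def subseq_at_def L_def)
    have SL: "set L = S" using finite_subset[OF sub] by (simp add: L_def)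
    have "length L = 4" using iso by (simp add: order_isomorphic_def)
    then obtain a b c d where L: "L = [a, b, c, d]"
      by (auto simp: numeral_eq_Suc length_Suc_conv)
    have "sorted_wrt (<) L" unfolding L_def by (rule strict_sorted_list_of_set)
    moreover have "{a, b, c, d} \<subseteq> {1..n}" using sub SL L by simp
    ultimately have "(a, b, c, d) \<in> quads {1..n} p"
      using iso \<open>{a, b, c, d} \<subseteq> {1..n}\<close> by (simp add: L order_isomorphic_3412[unfolded One_nat_def] mem_quads)
    moreover have "S = {a, b, c, d}" using SL L by simp
    ultimately show "S \<in> ?g ` quads {1..n} p"
      using image_eqI[of S ?g "(a, b, c, d)" "quads {1..n} p"] by simp
  qed
  ultimately show ?thesis using card_image[of ?g "quads {1..n} p"] by simp
qed

lemma I_3412_nth: "I_3412 r $ n = inv_poly n $ r"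
proof -
  have "inv_poly n $ r = (\<Sum>p\<in>inv_on {1..n}. if card (quads {1..n} p) = r then 1 else 0)"
    unfolding inv_poly_def inv_weight_def weight_def fps_sum_nth
    by (intro sum.cong) auto
  also have "\<dots> = real (card {p \<in> inv_on {1..n}. card (quads {1..n} p) = r})"
    by (simp add: sum.inter_filter[symmetric])
  finally show ?thesis
    unfolding I_3412_def involutions_eq_inv_on contains_exactly_def card_occurrences_3412 by simp
qed

section \<open>Generating functions\<close>

text \<open>Extraction of the coefficient of \<open>t^r\<close> from a series in the size variable
  whose coefficients are series in \<open>t\<close>.\<close>

definition inner_coeff :: "nat \<Rightarrow> 'a::comm_ring_1 fps fps \<Rightarrow> 'a fps" where
  "inner_coeff r F = Abs_fps (\<lambda>n. F $ n $ r)"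

lemma inner_coeff_nth [simp]: "inner_coeff r F $ n = F $ n $ r"
  by (simp add: inner_coeff_def)

lemma inner_coeff_add [simp]: "inner_coeff r (F + G) = inner_coeff r F + inner_coeff r G"
  by (simp add: fps_eq_iff)

lemma inner_coeff_diff [simp]: "inner_coeff r (F - G) = inner_coeff r F - inner_coeff r G"
  by (simp add: fps_eq_iff)

lemma inner_coeff_1 [simp]: "inner_coeff r 1 = (if r = 0 then 1 else 0)"
  by (simp add: fps_eq_iff)

lemma inner_coeff_mult: "inner_coeff r (F * G) = (\<Sum>l\<le>r. inner_coeff l F * inner_coeff (r - l) G)"
proof (rule fps_ext)
  fix n
  have "inner_coeff r (F * G) $ n = (\<Sum>i=0..n. \<Sum>l=0..r. F $ i $ l * G $ (n - i) $ (r - l))"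
    by (simp add: fps_mult_nth fps_sum_nth)
  also have "\<dots> = (\<Sum>l\<le>r. inner_coeff l F * inner_coeff (r - l) G) $ n"
    by (subst sum.swap) (simp add: fps_mult_nth fps_sum_nth atMost_atLeast0)
  finally show "inner_coeff r (F * G) $ n = \<dots>" .
qed

lemma inner_coeff_X [simp]: "inner_coeff r (fps_X * F) = fps_X * inner_coeff r F"
  by (simp add: fps_eq_iff)

text \<open>The series \<open>fps_const fps_X\<close> is \<open>t\<close>, seen as a constant of the
  outer ring; multiplying by it shifts the inner index.\<close>

lemma inner_coeff_const_X [simp]:
  "inner_coeff r (fps_const fps_X * F) = (if r = 0 then 0 else inner_coeff (r - 1) F)"
  by (simp add: fps_eq_iff)

lemma sqrt_1_2x_3x2_unique:
  fixes s :: "real fps"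
  assumes "s ^ 2 = 1 - 2 * fps_X - 3 * fps_X ^ 2" "s $ 0 = 1"
  shows "sqrt_1_2x_3x2 = s"
proof -
  have "s = fps_radical root (Suc 1) (1 - 2 * fps_X - 3 * fps_X ^ 2)"
    using assms by (subst radical_unique[symmetric]) (auto simp: numeral_2_eq_2)
  then show ?thesis by (simp add: sqrt_1_2x_3x2_def numeral_2_eq_2)
qed

text \<open>Multiplying \<open>a2\<close> by \<open>2 * x^2 * (1 - x) * s^2\<close> makes
  \<open>A1\<close> occur only in the product \<open>(1 - x) * s * A1\<close>, which
  \<open>a1\<close> expresses by \<open>A0\<close>. No division takes place, so the identity holds
  among power series.\<close>

lemma I_3412_elimination:
  fixes x A0 A1 A2 s :: "real fps"
  assumes a0: "A0 = 1 + x * A0 + x^2 * A0^2" and s: "s = 1 - x - 2 * x^2 * A0"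
    and a1: "(1 - x) * s * A1 = x^4 * A0^3"
    and a2: "(1 - x) * s * A2 = x^2 * ((1 - x) * A1^2 + (1 - x) * A0 * A1 + x^2 * A0^2 * A1)"
  shows "2 * x^2 * (1 - x)^2 * s^3 * A2
    = (1 - 2 * x) * (1 - x) * s^3 - (1 - 6 * x + 8 * x ^ 2 + 8 * x ^ 3 - 15 * x ^ 4 - 2 * x ^ 5 + 4 * x ^ 6)"
proof -
  \<comment> \<open>In terms of \<open>B\<close> both sides become polynomials in \<open>x\<close> and \<open>B\<close>, to be compared
    modulo the quadratic equation of \<open>B\<close>.\<close>
  define B where "B = x^2 * A0"
  have B: "B^2 = (1 - x) * B - x^2" unfolding B_def using a0 by algebra
  have sB: "s = 1 - x - 2 * B" using s B_def by simp
  have "2 * x^2 * (1 - x)^2 * s^3 * A2 = 2 * x^2 * s^2 * (1 - x) * ((1 - x) * s * A2)"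
    by (simp add: algebra_simps power2_eq_square power3_eq_cube)
  also have "\<dots> = 2 * x^4 * (((1 - x) * s * A1)^2 + (1 - x) * s * A0 * ((1 - x) * s * A1)
      + x^2 * s * A0^2 * ((1 - x) * s * A1))"
    unfolding a2 by algebra
  also have "\<dots> = 2 * (B^6 + (1 - x) * s * B^4 + s * B^5)"
    unfolding a1 B_def by algebra
  also have "\<dots> = (1 - 2 * x) * (1 - x) * s^3 - (1 - 6 * x + 8 * x ^ 2 + 8 * x ^ 3 - 15 * x ^ 4 - 2 * x ^ 5 + 4 * x ^ 6)"
    using B unfolding sB by algebra
  finally show ?thesis .
qed

section \<open>The functional equation and its coefficients in \<open>t\<close>\<close>

lemma sum_convolution_shift:
  "(\<Sum>k=2..Suc (Suc m). f (k - 2) * g (Suc (Suc m) - k)) = (\<Sum>i=0..m. f i * g (m - i))"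
  for f g :: "nat \<Rightarrow> 'a::comm_semiring_0"
  by (rule sum.reindex_bij_witness[of _ "\<lambda>i. i + 2" "\<lambda>k. k - 2"]) auto

text \<open>The outer variable marks the size of the involution, the inner one its occurrences of 3412.\<close>

definition inv_series :: "real fps fps" where
  "inv_series = Abs_fps inv_poly"

text \<open>This is \<open>x F / (1 - x)\<close>. The strict bound matches
  \<open>b - 2 < k - 2\<close>: the part before \<open>b\<close> has \<open>b - 2\<close> points,
  and the rest up to \<open>k\<close> is forced.\<close>

definition inv_partial_sums :: "real fps fps" where
  "inv_partial_sums = Abs_fps (\<lambda>k. \<Sum>i<k. inv_poly i)"

text \<open>This is \<open>(F - 1 - x F) / x\<close>; the coefficient belongs to a block of
  \<open>n + 1\<close> points whose minimum is not fixed.\<close>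

definition inv_differences :: "real fps fps" where
  "inv_differences = Abs_fps (\<lambda>n. inv_poly (n + 1) - inv_poly n)"

lemma inv_partial_sums_eq: "inv_partial_sums = fps_X * inv_partial_sums + fps_X * inv_series"
proof (rule fps_ext)
  fix n show "inv_partial_sums $ n = (fps_X * inv_partial_sums + fps_X * inv_series) $ n"
    by (cases n) (auto simp: inv_partial_sums_def inv_series_def)
qed

lemma inv_differences_eq: "fps_X * inv_differences = inv_series - 1 - fps_X * inv_series"
proof (rule fps_ext)
  fix n show "(fps_X * inv_differences) $ n = (inv_series - 1 - fps_X * inv_series) $ n"
    by (cases n) (auto simp: inv_differences_def inv_series_def inv_poly_0)
qed

text \<open>The functional equation of the idea, read off from \<open>inv_poly_rec\<close>
  coefficient by coefficient and restricted to the powers of \<open>t\<close> below 3.\<close>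

lemma inner_coeff_inv_series:
  assumes r: "r < 3"
  shows "inner_coeff r inv_series = inner_coeff r (1 + fps_X * inv_series + fps_X * (fps_X * (inv_series * inv_series))
     + fps_const fps_X * (fps_X * (fps_X * (inv_partial_sums * inv_differences))))"
proof (rule fps_ext)
  fix n
  \<comment> \<open>Both sums of the recurrence start at \<open>k = 2\<close>, which accounts for
    the factor \<open>x^2\<close>; for smaller sizes they are empty.\<close>
  consider "n = 0" | "n = 1" | m where "n = Suc (Suc m)"
    by (metis One_nat_def not0_implies_Suc)
  then show "inner_coeff r inv_series $ n = inner_coeff r (1 + fps_X * inv_series
      + fps_X * (fps_X * (inv_series * inv_series))
      + fps_const fps_X * (fps_X * (fps_X * (inv_partial_sums * inv_differences)))) $ n"
  proof cases
    case 1
    then show ?thesis by (simp add: inv_series_def inv_poly_0)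
  next
    case 2
    then show ?thesis using inv_poly_rec[of 1 r] r by (simp add: inv_series_def)
  next
    case (3 m)
    \<comment> \<open>The difference factor does not depend on \<open>b\<close>, so summing over
      \<open>b\<close> leaves a partial sum.\<close>
    have "(\<Sum>k=2..n. \<Sum>b=2..<k. fps_X * inv_poly (b - 2) * (inv_poly (n - k + 1) - inv_poly (n - k)))
        = (\<Sum>k=2..n. fps_X * ((\<Sum>i<k - 2. inv_poly i) * (inv_poly (n - k + 1) - inv_poly (n - k))))"
    proof (rule sum.cong)
      fix k assume "k \<in> {2..n}"
      have "(\<Sum>b=2..<k. inv_poly (b - 2)) = (\<Sum>i<k - 2. inv_poly i)"
        by (rule sum.reindex_bij_witness[of _ "\<lambda>i. i + 2" "\<lambda>b. b - 2"]) auto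
      then show "(\<Sum>b=2..<k. fps_X * inv_poly (b - 2) * (inv_poly (n - k + 1) - inv_poly (n - k)))
          = fps_X * ((\<Sum>i<k - 2. inv_poly i) * (inv_poly (n - k + 1) - inv_poly (n - k)))"
        by (simp add: sum_distrib_left[symmetric] sum_distrib_right[symmetric] mult.assoc)
    qed simp
    also have "\<dots> = fps_X * (\<Sum>i=0..m. (\<Sum>j<i. inv_poly j) * (inv_poly (m - i + 1) - inv_poly (m - i)))"
      unfolding 3 sum_distrib_left[symmetric]
      using sum_convolution_shift[of "\<lambda>i. \<Sum>j<i. inv_poly j" "\<lambda>j. inv_poly (j + 1) - inv_poly j" m]
      by simp
    finally have crossing: "(\<Sum>k=2..n. \<Sum>b=2..<k. fps_X * inv_poly (b - 2) * (inv_poly (n - k + 1) - inv_poly (n - k)))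
        = fps_X * (\<Sum>i=0..m. (\<Sum>j<i. inv_poly j) * (inv_poly (m - i + 1) - inv_poly (m - i)))" .
    have arc: "(\<Sum>k=2..n. inv_poly (k - 2) * inv_poly (n - k)) = (\<Sum>i=0..m. inv_poly i * inv_poly (m - i))"
      unfolding 3 by (rule sum_convolution_shift)
    have "1 \<le> n" using 3 by simp
    from inv_poly_rec[OF this r]
    have "inv_poly n $ r = (inv_poly (n - 1) + (\<Sum>i=0..m. inv_poly i * inv_poly (m - i))
      + fps_X * (\<Sum>i=0..m. (\<Sum>j<i. inv_poly j) * (inv_poly (m - i + 1) - inv_poly (m - i)))) $ r"
      unfolding arc crossing .
    then show ?thesis
      by (simp add: 3 inv_series_def inv_partial_sums_def inv_differences_def fps_mult_nth[where 'a = "real fps"])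
  qed
qed

lemma I_3412_eq_inner_coeff: "I_3412 r = inner_coeff r inv_series"
  by (simp add: fps_eq_iff I_3412_nth inv_series_def)

text \<open>The crossing term carries a factor \<open>t\<close>, so it involves only lower
  coefficients. The equations for \<open>t^1\<close> and \<open>t^2\<close> are therefore linear in
  the new unknown, with factor \<open>s\<close> coming from \<open>x F + x^2 F^2\<close>.\<close>

lemma I_3412_equations:
  defines "x \<equiv> (fps_X :: real fps)"
  defines "s \<equiv> 1 - x - 2 * x ^ 2 * I_3412 0"
  shows "I_3412 0 = 1 + x * I_3412 0 + x ^ 2 * I_3412 0 ^ 2"
    and "(1 - x) * s * I_3412 1 = x ^ 4 * I_3412 0 ^ 3"
    and "(1 - x) * s * I_3412 2 = x ^ 2 * ((1 - x) * I_3412 1 ^ 2 + (1 - x) * I_3412 0 * I_3412 1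
           + x ^ 2 * I_3412 0 ^ 2 * I_3412 1)"
proof -
  define A where "A r = I_3412 r" for r
  define S where "S r = inner_coeff r inv_partial_sums" for r
  define D where "D r = inner_coeff r inv_differences" for r
  note convs = inner_coeff_mult[of _ inv_series inv_series] inner_coeff_mult[of _ inv_partial_sums inv_differences]
  note defs = A_def S_def D_def I_3412_eq_inner_coeff x_def
  have SA: "S r = x * S r + x * A r" for r
    using arg_cong[OF inv_partial_sums_eq, of "inner_coeff r"] by (simp add: defs)
  have DA: "x * D r = A r - (if r = 0 then 1 else 0) - x * A r" for r
    using arg_cong[OF inv_differences_eq, of "inner_coeff r"] by (simp add: defs)
  have e0: "A 0 = 1 + x * A 0 + x * (x * (A 0 * A 0))"
    using inner_coeff_inv_series[of 0] by (simp add: defs convs)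
  have e1: "A 1 = x * A 1 + x * (x * (A 0 * A 1 + A 1 * A 0)) + x * (x * (S 0 * D 0))"
    using inner_coeff_inv_series[of 1] by (simp add: defs convs)
  have e2: "A 2 = x * A 2 + x * (x * (A 0 * A 2 + A 1 * A 1 + A 2 * A 0))
      + x * (x * (S 0 * D 1 + S 1 * D 0))"
    using inner_coeff_inv_series[of 2] by (simp add: defs convs numeral_2_eq_2)
  have S0: "S 0 = x * S 0 + x * A 0" and S1: "S 1 = x * S 1 + x * A 1" using SA by blast+
  have D0: "x * D 0 = A 0 - 1 - x * A 0" and D1: "x * D 1 = A 1 - x * A 1"
    using DA[of 0] DA[of 1] by simp_all
  have s: "s = 1 - x - 2 * x ^ 2 * A 0" by (simp add: s_def A_def)
  have "A 0 = 1 + x * A 0 + x ^ 2 * A 0 ^ 2" using e0 by algebra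
  \<comment> \<open>Here \<open>(1 - x) * S 0 = x * A 0\<close>, and
    \<open>x * D 0 = x^2 * A 0 ^ 2\<close> by the quadratic equation.\<close>
  moreover have "(1 - x) * s * A 1 = x ^ 4 * A 0 ^ 3"
    using e0 e1 S0 D0 unfolding s by algebra
  moreover have "(1 - x) * s * A 2 = x ^ 2 * ((1 - x) * A 1 ^ 2 + (1 - x) * A 0 * A 1 + x ^ 2 * A 0 ^ 2 * A 1)"
    using e0 e2 S0 S1 D0 D1 unfolding s by algebra
  ultimately show "I_3412 0 = 1 + x * I_3412 0 + x ^ 2 * I_3412 0 ^ 2"
    "(1 - x) * s * I_3412 1 = x ^ 4 * I_3412 0 ^ 3"
    "(1 - x) * s * I_3412 2 = x ^ 2 * ((1 - x) * I_3412 1 ^ 2 + (1 - x) * I_3412 0 * I_3412 1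
           + x ^ 2 * I_3412 0 ^ 2 * I_3412 1)"
    by (simp_all add: A_def)
qed

text \<open>Completing the square in the quadratic equation gives
  \<open>(1 - x)^2 - 4 * x^2\<close>; the constant coefficient 1 selects the branch.\<close>

lemma sqrt_eq_I_3412_0: "sqrt_1_2x_3x2 = 1 - fps_X - 2 * fps_X ^ 2 * I_3412 0"
proof (rule sqrt_1_2x_3x2_unique)
  show "(1 - fps_X - 2 * fps_X ^ 2 * I_3412 0) ^ 2 = 1 - 2 * fps_X - 3 * fps_X ^ 2"
    using I_3412_equations(1) by algebra
qed (simp add: power2_eq_square mult.assoc)

(* The two summands have a pole at x = 0, so the identity is one of formal Laurent series. *)
theorem corollary3p5:
  defines "x \<equiv> (fls_X :: real fls)"
  shows "fps_to_fls (I_3412 2) =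
     (1 - 2 * x) / (2 * x ^ 2 * (1 - x))
     - (1 - 6 * x + 8 * x ^ 2 + 8 * x ^ 3 - 15 * x ^ 4 - 2 * x ^ 5 + 4 * x ^ 6)
         / (2 * x ^ 2 * (1 - x) ^ 2)
       * fps_to_fls sqrt_1_2x_3x2 powi (-3)"
proof -
  define s where "s = fps_to_fls sqrt_1_2x_3x2"
  define a where "a = fps_to_fls (I_3412 2)"
  define P where "P = 1 - 6 * x + 8 * x ^ 2 + 8 * x ^ 3 - 15 * x ^ 4 - 2 * x ^ 5 + 4 * x ^ 6"
  have X: "x = fps_to_fls fps_X" by (simp add: x_def)
  have "x \<noteq> 0" by (simp add: x_def)
  have "1 - x = fps_to_fls (1 - fps_X)" by (simp add: X)
  moreover have "(1 - fps_X :: real fps) \<noteq> 0"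
    by (metis fps_nonzero_nth fps_sub_nth fps_one_nth fps_X_nth diff_zero zero_neq_one)
  ultimately have "1 - x \<noteq> 0" by (metis fps_to_fls_eq_0_iff)
  have "sqrt_1_2x_3x2 $ 0 = 1"
    by (simp add: sqrt_eq_I_3412_0 power2_eq_square mult.assoc)
  then have "s \<noteq> 0" by (auto simp: s_def)
  have "2 * x ^ 2 * (1 - x) ^ 2 * s ^ 3 * a = (1 - 2 * x) * (1 - x) * s ^ 3 - P"
    using arg_cong[OF I_3412_elimination[OF I_3412_equations(1) sqrt_eq_I_3412_0
        I_3412_equations(2,3)[folded sqrt_eq_I_3412_0]], of fps_to_fls]
    by (simp add: X s_def a_def P_def fls_times_fps_to_fls fps_to_fls_power)
  \<comment> \<open>Laurent series form a field, so the polynomial identity can be divided by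
    \<open>2 * x^2 * (1 - x)^2 * s^3\<close>.\<close>
  then have "a = (1 - 2 * x) / (2 * x ^ 2 * (1 - x)) - P / (2 * x ^ 2 * (1 - x) ^ 2) * inverse (s ^ 3)"
    using \<open>x \<noteq> 0\<close> \<open>1 - x \<noteq> 0\<close> \<open>s \<noteq> 0\<close>
    by (simp add: divide_simps) algebra
  moreover have "s powi (-3) = inverse (s ^ 3)"
    by (simp add: power_int_minus)
  ultimately show ?thesis by (simp add: a_def s_def P_def)
qed

end
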